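(* Let $A$ and $B$ be sets. Let $E_{AB}=\mathbf{Top}(A^{\mathbb{N}},B^{\mathbb{N}})$ be the set of continuous functions $A^{\mathbb{N}}\to B^{\mathbb{N}}$, made into an $A$-ary magma by $\mathsf{split}$, and equipped with the magma homomorphism $\delta\colon E_{AB}\to B\cdot E_{AB}$ given as the composite of postcomposition with the homeomorphism $h\colon B^{\mathbb{N}}\to B\cdot B^{\mathbb{N}}$, $h(\vec b)=(b_0,\partial\vec b)$, followed by the inverse of the canonical comparison isomorphism $B\cdot\mathbf{Top}(A^{\mathbb{N}},B^{\mathbb{N}})\to\mathbf{Top}(A^{\mathbb{N}},B\cdot B^{\mathbb{N}})$. Then $(E_{AB},\mathsf{split},\delta)$ is a final $\mathbb{T}_A$-$\mathbb{T}_B$-bimodel. In particular, the set of continuous functions $A^{\mathbb{N}}\to B^{\mathbb{N}}$ is the underlying set of the terminal $B$-ary comagma in the category of $A$-ary magmas.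
   Context: An $A$-ary magma is a set $X$ with a function $\xi\colon X^A\to X$ (no axioms); homomorphisms commute with these operations. The category of $A$-ary magmas has all coproducts; $B\cdot\mathcal{X}$ denotes the coproduct of $B$ copies of $\mathcal{X}$. A $\mathbb{T}_A$-$\mathbb{T}_B$-bimodel (equivalently, a $B$-ary comagma in the category of $A$-ary magmas) is an $A$-ary magma $\mathcal{K}$ with a magma homomorphism $\delta\colon\mathcal{K}\to B\cdot\mathcal{K}$; a map of bimodels $(\mathcal{K},\delta)\to(\mathcal{K}',\delta')$ is a magma homomorphism $f$ with $\delta'\circ f=(B\cdot f)\circ\delta$; final means terminal in this category. $A^{\mathbb{N}}$, $B^{\mathbb{N}}$ carry the product of discrete topologies; $\partial$ is the shift $(x_0,x_1,\dots)\mapsto(x_1,x_2,\dots)$; $B\cdot B^{\mathbb{N}}$ is the topological coproduct $B\times B^{\mathbb{N}}$ with $B$ discrete. For a space $C$, $\mathbf{Top}(A^{\mathbb{N}},C)$ is an $A$-ary magma via $\mathsf{split}(\vec f)(\vec a)=f_{a_0}(\partial\vec a)$. The canonical comparison map $B\cdot\mathbf{Top}(A^{\mathbb{N}},B^{\mathbb{N}})\to\mathbf{Top}(A^{\mathbb{N}},B\cdot B^{\mathbb{N}})$ is the magma homomorphism whose $b$-th component is $f\mapsto\iota_b\circ f$ ($\iota_b$ the $b$-th coproduct injection of spaces); it is an isomorphism of magmas. *)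

theory Defs
  imports "HOL-Analysis.Analysis"
begin

section \<open>Magmas of a given arity\<close>

text \<open>
  The arity \<open>A\<close> is an arbitrary, possibly empty, set.  The power \<open>X\<^sup>A\<close> is the set
  \<open>A \<rightarrow>\<^sub>E X\<close> of functions that are \<open>undefined\<close> outside \<open>A\<close>; likewise homomorphisms are
  \<open>undefined\<close> outside the carrier of their source, so that equality of homomorphisms is equality
  in HOL.
\<close>

record ('a, 'x) magma =
  mcarrier :: "'x set"
  mop :: "('a \<Rightarrow> 'x) \<Rightarrow> 'x"

definition is_magma :: "'a set \<Rightarrow> ('a, 'x) magma \<Rightarrow> bool" where
  "is_magma A M \<longleftrightarrow> (\<forall>f \<in> A \<rightarrow>\<^sub>E mcarrier M. mop M f \<in> mcarrier M)"

definition magma_hom :: "'a set \<Rightarrow> ('a, 'x) magma \<Rightarrow> ('a, 'y) magma \<Rightarrow> ('x \<Rightarrow> 'y) set" where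
  "magma_hom A M N =
    {h \<in> mcarrier M \<rightarrow>\<^sub>E mcarrier N.
      \<forall>f \<in> A \<rightarrow>\<^sub>E mcarrier M. h (mop M f) = mop N (\<lambda>a\<in>A. h (f a))}"


section \<open>Coproducts of magmas\<close>

text \<open>
  The coproduct of a family \<open>M\<close> of magmas indexed by \<open>B\<close> is the magma of terms over the
  disjoint union of the carriers, modulo the least congruence that makes each inclusion of
  generators a homomorphism.  The universal property is \<open>coprod_universal\<close> below.
\<close>

datatype ('a, 'g) mterm = Gen 'g | Op "'a \<Rightarrow> ('a, 'g) mterm"

inductive_set mterms :: "'a set \<Rightarrow> 'g set \<Rightarrow> ('a, 'g) mterm set"
  for A :: "'a set" and G :: "'g set" where
  Gen: "g \<in> G \<Longrightarrow> Gen g \<in> mterms A G"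
| Op: "(\<And>a. a \<in> A \<Longrightarrow> f a \<in> mterms A G) \<Longrightarrow> f \<in> extensional A \<Longrightarrow> Op f \<in> mterms A G"

abbreviation coprod_terms ::
    "'a set \<Rightarrow> 'b set \<Rightarrow> ('b \<Rightarrow> ('a, 'x) magma) \<Rightarrow> ('a, 'b \<times> 'x) mterm set" where
  "coprod_terms A B M \<equiv> mterms A (SIGMA b:B. mcarrier (M b))"

inductive_set coprod_cong ::
    "'a set \<Rightarrow> 'b set \<Rightarrow> ('b \<Rightarrow> ('a, 'x) magma) \<Rightarrow>
      (('a, 'b \<times> 'x) mterm \<times> ('a, 'b \<times> 'x) mterm) set"
  for A :: "'a set" and B :: "'b set" and M :: "'b \<Rightarrow> ('a, 'x) magma" where
  refl: "t \<in> coprod_terms A B M \<Longrightarrow> (t, t) \<in> coprod_cong A B M"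
| sym: "(s, t) \<in> coprod_cong A B M \<Longrightarrow> (t, s) \<in> coprod_cong A B M"
| trans: "(s, t) \<in> coprod_cong A B M \<Longrightarrow> (t, u) \<in> coprod_cong A B M \<Longrightarrow>
    (s, u) \<in> coprod_cong A B M"
| Op: "(\<And>a. a \<in> A \<Longrightarrow> (f a, g a) \<in> coprod_cong A B M) \<Longrightarrow>
    f \<in> extensional A \<Longrightarrow> g \<in> extensional A \<Longrightarrow> (Op f, Op g) \<in> coprod_cong A B M"
| mop: "b \<in> B \<Longrightarrow> f \<in> A \<rightarrow>\<^sub>E mcarrier (M b) \<Longrightarrow>
    (Gen (b, mop (M b) f), Op (\<lambda>a\<in>A. Gen (b, f a))) \<in> coprod_cong A B M"

definition coprod ::
    "'a set \<Rightarrow> 'b set \<Rightarrow> ('b \<Rightarrow> ('a, 'x) magma) \<Rightarrow> ('a, ('a, 'b \<times> 'x) mterm set) magma" where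
  "coprod A B M =
    \<lparr> mcarrier = coprod_terms A B M // coprod_cong A B M,
      mop = (\<lambda>F. coprod_cong A B M `` {Op (\<lambda>a\<in>A. SOME t. t \<in> F a)}) \<rparr>"

definition coprod_inj ::
    "'a set \<Rightarrow> 'b set \<Rightarrow> ('b \<Rightarrow> ('a, 'x) magma) \<Rightarrow> 'b \<Rightarrow> 'x \<Rightarrow> ('a, 'b \<times> 'x) mterm set" where
  "coprod_inj A B M b = (\<lambda>x\<in>mcarrier (M b). coprod_cong A B M `` {Gen (b, x)})"

definition cotuple ::
    "'a set \<Rightarrow> 'b set \<Rightarrow> ('b \<Rightarrow> ('a, 'x) magma) \<Rightarrow> ('a, 'y) magma \<Rightarrow> ('b \<Rightarrow> 'x \<Rightarrow> 'y) \<Rightarrow>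
      ('a, 'b \<times> 'x) mterm set \<Rightarrow> 'y" where
  "cotuple A B M N h =
    (THE g. g \<in> magma_hom A (coprod A B M) N \<and>
      (\<forall>b\<in>B. \<forall>x\<in>mcarrier (M b). g (coprod_inj A B M b x) = h b x))"

definition copower ::
    "'a set \<Rightarrow> 'b set \<Rightarrow> ('a, 'x) magma \<Rightarrow> ('a, ('a, 'b \<times> 'x) mterm set) magma" where
  "copower A B K = coprod A B (\<lambda>_. K)"

definition copower_map ::
    "'a set \<Rightarrow> 'b set \<Rightarrow> ('a, 'x) magma \<Rightarrow> ('a, 'y) magma \<Rightarrow> ('x \<Rightarrow> 'y) \<Rightarrow>
      ('a, 'b \<times> 'x) mterm set \<Rightarrow> ('a, 'b \<times> 'y) mterm set" where
  "copower_map A B K L f =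
    cotuple A B (\<lambda>_. K) (copower A B L) (\<lambda>b x. coprod_inj A B (\<lambda>_. L) b (f x))"


subsection \<open>The universal property\<close>

lemma coprod_cong_terms:
  assumes "\<forall>b\<in>B. is_magma A (M b)" and "(s, t) \<in> coprod_cong A B M"
  shows "s \<in> coprod_terms A B M \<and> t \<in> coprod_terms A B M"
  using assms(2)
proof induction
  case (mop b f)
  have "mop (M b) f \<in> mcarrier (M b)"
    using assms(1) mop by (simp add: is_magma_def)
  moreover have "Op (\<lambda>a\<in>A. Gen (b, f a)) \<in> coprod_terms A B M"
    using mop by (intro mterms.Op) (auto intro!: mterms.Gen)
  ultimately show ?case
    using mop(1) by (auto intro: mterms.Gen)
qed (auto intro: mterms.Op)

lemma equiv_coprod_cong:
  assumes "\<forall>b\<in>B. is_magma A (M b)"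
  shows "equiv (coprod_terms A B M) (coprod_cong A B M)"
proof (rule equivI)
  show "coprod_cong A B M \<subseteq> coprod_terms A B M \<times> coprod_terms A B M"
    using coprod_cong_terms[OF assms] by auto
  show "refl_on (coprod_terms A B M) (coprod_cong A B M)"
    by (auto simp: refl_on_def intro: coprod_cong.refl)
  show "sym (coprod_cong A B M)"
    by (auto intro: symI coprod_cong.sym)
  show "trans (coprod_cong A B M)"
    by (auto intro: transI coprod_cong.trans)
qed

lemma coprod_mop_class:
  assumes M: "\<forall>b\<in>B. is_magma A (M b)"
    and f: "\<And>a. a \<in> A \<Longrightarrow> f a \<in> coprod_terms A B M"
    and F: "\<And>a. a \<in> A \<Longrightarrow> F a = coprod_cong A B M `` {f a}"
  shows "mop (coprod A B M) F = coprod_cong A B M `` {Op (restrict f A)}"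
proof -
  have some: "(f a, SOME t. t \<in> F a) \<in> coprod_cong A B M" if "a \<in> A" for a
  proof -
    have "(SOME t. t \<in> F a) \<in> F a"
      using F[OF that] coprod_cong.refl[OF f[OF that]] by (metis ImageI insertI1 someI_ex)
    then show ?thesis
      using F[OF that] by auto
  qed
  have "(Op (restrict f A), Op (\<lambda>a\<in>A. SOME t. t \<in> F a)) \<in> coprod_cong A B M"
    using some by (intro coprod_cong.Op) auto
  then show ?thesis
    using equiv_class_eq[OF equiv_coprod_cong[OF M]] by (simp add: coprod_def)
qed

lemma coprod_representatives:
  assumes "F \<in> A \<rightarrow>\<^sub>E mcarrier (coprod A B M)"
  obtains f where "\<And>a. a \<in> A \<Longrightarrow> f a \<in> coprod_terms A B M"
    and "\<And>a. a \<in> A \<Longrightarrow> F a = coprod_cong A B M `` {f a}"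
proof -
  have "\<forall>a\<in>A. \<exists>t. t \<in> coprod_terms A B M \<and> F a = coprod_cong A B M `` {t}"
    using assms by (auto simp: coprod_def PiE_iff quotient_def)
  then show ?thesis
    using that by metis
qed

lemma is_magma_coprod:
  assumes "\<forall>b\<in>B. is_magma A (M b)"
  shows "is_magma A (coprod A B M)"
  unfolding is_magma_def
proof
  fix F assume F: "F \<in> A \<rightarrow>\<^sub>E mcarrier (coprod A B M)"
  obtain f where f: "\<And>a. a \<in> A \<Longrightarrow> f a \<in> coprod_terms A B M"
    and Ff: "\<And>a. a \<in> A \<Longrightarrow> F a = coprod_cong A B M `` {f a}"
    using coprod_representatives[OF F] by blast
  have "Op (restrict f A) \<in> coprod_terms A B M"
    using f by (intro mterms.Op) auto
  moreover have "mop (coprod A B M) F = coprod_cong A B M `` {Op (restrict f A)}"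
    using assms f Ff by (rule coprod_mop_class)
  ultimately show "mop (coprod A B M) F \<in> mcarrier (coprod A B M)"
    by (simp add: coprod_def quotientI)
qed

lemma coprod_inj_hom:
  assumes M: "\<forall>b\<in>B. is_magma A (M b)" and b: "b \<in> B"
  shows "coprod_inj A B M b \<in> magma_hom A (M b) (coprod A B M)"
proof -
  have "coprod_inj A B M b \<in> mcarrier (M b) \<rightarrow>\<^sub>E mcarrier (coprod A B M)"
    using b by (auto simp: coprod_inj_def coprod_def intro!: quotientI mterms.Gen)
  moreover have "coprod_inj A B M b (mop (M b) f) =
      mop (coprod A B M) (\<lambda>a\<in>A. coprod_inj A B M b (f a))"
    if f: "f \<in> A \<rightarrow>\<^sub>E mcarrier (M b)" for f
  proof -
    have "mop (M b) f \<in> mcarrier (M b)"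
      using M b f by (simp add: is_magma_def)
    then have "coprod_inj A B M b (mop (M b) f) = coprod_cong A B M `` {Op (\<lambda>a\<in>A. Gen (b, f a))}"
      using equiv_class_eq[OF equiv_coprod_cong[OF M] coprod_cong.mop[where M = M, OF b f]]
      by (simp add: coprod_inj_def)
    moreover have "mop (coprod A B M) (\<lambda>a\<in>A. coprod_inj A B M b (f a)) =
        coprod_cong A B M `` {Op (\<lambda>a\<in>A. Gen (b, f a))}"
      using f b by (intro coprod_mop_class[OF M]) (auto simp: coprod_inj_def intro!: mterms.Gen)
    ultimately show ?thesis
      by simp
  qed
  ultimately show ?thesis
    by (simp add: magma_hom_def)
qed

primrec mterm_eval ::
    "'a set \<Rightarrow> ('a, 'y) magma \<Rightarrow> ('g \<Rightarrow> 'y) \<Rightarrow> ('a, 'g) mterm \<Rightarrow> 'y" where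
  "mterm_eval A N h (Gen g) = h g"
| "mterm_eval A N h (Op f) = mop N (\<lambda>a\<in>A. mterm_eval A N h (f a))"

lemma mterm_eval_closed:
  assumes "is_magma A N" and "\<And>g. g \<in> G \<Longrightarrow> h g \<in> mcarrier N" and "t \<in> mterms A G"
  shows "mterm_eval A N h t \<in> mcarrier N"
  using assms(3)
proof induction
  case (Op f)
  have "(\<lambda>a\<in>A. mterm_eval A N h (f a)) \<in> A \<rightarrow>\<^sub>E mcarrier N"
    using Op by auto
  with assms(1) show ?case
    by (auto simp: is_magma_def)
qed (use assms(2) in simp)

lemma mterm_eval_cong:
  assumes "\<forall>b\<in>B. h b \<in> magma_hom A (M b) N" and "(s, t) \<in> coprod_cong A B M"
  shows "mterm_eval A N (\<lambda>(b, x). h b x) s = mterm_eval A N (\<lambda>(b, x). h b x) t"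
  using assms(2)
proof induction
  case (Op f g)
  then have "(\<lambda>a\<in>A. mterm_eval A N (\<lambda>(b, x). h b x) (f a)) =
      (\<lambda>a\<in>A. mterm_eval A N (\<lambda>(b, x). h b x) (g a))"
    by (intro restrict_ext) auto
  then show ?case
    by simp
next
  case (mop b f)
  have "(\<lambda>a\<in>A. mterm_eval A N (\<lambda>(b, x). h b x) ((\<lambda>a\<in>A. Gen (b, f a)) a)) = (\<lambda>a\<in>A. h b (f a))"
    by (intro restrict_ext) auto
  then show ?case
    using assms(1) mop by (simp add: magma_hom_def)
qed auto

theorem coprod_universal:
  assumes M: "\<forall>b\<in>B. is_magma A (M b)" and N: "is_magma A N"
    and h: "\<forall>b\<in>B. h b \<in> magma_hom A (M b) N"
  shows "\<exists>!g. g \<in> magma_hom A (coprod A B M) N \<and>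
    (\<forall>b\<in>B. \<forall>x\<in>mcarrier (M b). g (coprod_inj A B M b x) = h b x)"
proof (rule ex_ex1I)
  let ?C = "coprod A B M" and ?R = "coprod_cong A B M"
  let ?ev = "mterm_eval A N (\<lambda>(b, x). h b x)"
  define g where "g = (\<lambda>c\<in>mcarrier ?C. ?ev (SOME t. t \<in> c))"
  have g: "g (?R `` {t}) = ?ev t" if t: "t \<in> coprod_terms A B M" for t
  proof -
    have "(SOME s. s \<in> ?R `` {t}) \<in> ?R `` {t}"
      using coprod_cong.refl[OF t] by (metis ImageI insertI1 someI_ex)
    then have "?ev (SOME s. s \<in> ?R `` {t}) = ?ev t"
      using mterm_eval_cong[OF h] by force
    moreover have "?R `` {t} \<in> mcarrier ?C"
      using t by (simp add: coprod_def quotientI)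
    ultimately show ?thesis
      by (simp add: g_def)
  qed
  have ev: "?ev t \<in> mcarrier N" if "t \<in> coprod_terms A B M" for t
    using that h by (intro mterm_eval_closed[OF N]) (auto simp: magma_hom_def)
  have "g \<in> mcarrier ?C \<rightarrow>\<^sub>E mcarrier N"
  proof (rule PiE_I)
    fix c assume "c \<in> mcarrier ?C"
    then obtain t where "t \<in> coprod_terms A B M" "c = ?R `` {t}"
      by (auto simp: coprod_def quotient_def)
    then show "g c \<in> mcarrier N"
      using g ev by simp
  qed (simp add: g_def)
  moreover have "g (mop ?C F) = mop N (\<lambda>a\<in>A. g (F a))" if F: "F \<in> A \<rightarrow>\<^sub>E mcarrier ?C" for F
  proof -
    obtain f where f: "\<And>a. a \<in> A \<Longrightarrow> f a \<in> coprod_terms A B M"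
      and Ff: "\<And>a. a \<in> A \<Longrightarrow> F a = ?R `` {f a}"
      using coprod_representatives[OF F] by blast
    have "Op (restrict f A) \<in> coprod_terms A B M"
      using f by (intro mterms.Op) auto
    moreover have "mop ?C F = ?R `` {Op (restrict f A)}"
      using M f Ff by (rule coprod_mop_class)
    ultimately have "g (mop ?C F) = ?ev (Op (restrict f A))"
      using g by simp
    also have "\<dots> = mop N (\<lambda>a\<in>A. ?ev (restrict f A a))"
      by simp
    also have "(\<lambda>a\<in>A. ?ev (restrict f A a)) = (\<lambda>a\<in>A. g (F a))"
      using f Ff g by (intro restrict_ext) simp
    finally show ?thesis .
  qed
  moreover have "g (coprod_inj A B M b x) = h b x" if "b \<in> B" "x \<in> mcarrier (M b)" for b x
    using that g[of "Gen (b, x)"] by (simp add: coprod_inj_def mterms.Gen)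
  ultimately show "\<exists>g. g \<in> magma_hom A ?C N \<and>
      (\<forall>b\<in>B. \<forall>x\<in>mcarrier (M b). g (coprod_inj A B M b x) = h b x)"
    by (auto simp: magma_hom_def)
next
  let ?C = "coprod A B M" and ?R = "coprod_cong A B M"
  fix g g'
  assume g: "g \<in> magma_hom A ?C N \<and>
      (\<forall>b\<in>B. \<forall>x\<in>mcarrier (M b). g (coprod_inj A B M b x) = h b x)"
    and g': "g' \<in> magma_hom A ?C N \<and>
      (\<forall>b\<in>B. \<forall>x\<in>mcarrier (M b). g' (coprod_inj A B M b x) = h b x)"
  have eq: "g (?R `` {t}) = g' (?R `` {t})" if "t \<in> coprod_terms A B M" for t
    using that
  proof induction
    case (Gen bx)
    then show ?case
      using g g' by (auto simp: coprod_inj_def)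
  next
    case (Op f)
    define F where "F = (\<lambda>a\<in>A. ?R `` {f a})"
    have F: "F \<in> A \<rightarrow>\<^sub>E mcarrier ?C"
      using Op by (auto simp: F_def coprod_def intro: quotientI)
    have "mop ?C F = ?R `` {Op (restrict f A)}"
      using Op by (intro coprod_mop_class[OF M]) (auto simp: F_def)
    then have mop: "mop ?C F = ?R `` {Op f}"
      using Op.hyps by (simp add: extensional_restrict)
    have "(\<lambda>a\<in>A. g (F a)) = (\<lambda>a\<in>A. g' (F a))"
      using Op by (intro restrict_ext) (simp add: F_def)
    moreover have "g (mop ?C F) = mop N (\<lambda>a\<in>A. g (F a))"
      and "g' (mop ?C F) = mop N (\<lambda>a\<in>A. g' (F a))"
      using g g' F by (auto simp: magma_hom_def)
    ultimately show ?case
      using mop by simp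
  qed
  show "g = g'"
  proof (rule extensionalityI[of _ "mcarrier ?C"])
    show "g \<in> extensional (mcarrier ?C)" "g' \<in> extensional (mcarrier ?C)"
      using g g' by (auto simp: magma_hom_def PiE_iff)
    fix c assume "c \<in> mcarrier ?C"
    then obtain t where "t \<in> coprod_terms A B M" "c = ?R `` {t}"
      by (auto simp: coprod_def quotient_def)
    then show "g c = g' c"
      using eq by simp
  qed
qed


section \<open>Bimodels\<close>

definition bimodel ::
    "'a set \<Rightarrow> 'b set \<Rightarrow> ('a, 'x) magma \<Rightarrow> ('x \<Rightarrow> ('a, 'b \<times> 'x) mterm set) \<Rightarrow> bool" where
  "bimodel A B K \<delta> \<longleftrightarrow> is_magma A K \<and> \<delta> \<in> magma_hom A K (copower A B K)"

definition bimodel_map ::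
    "'a set \<Rightarrow> 'b set \<Rightarrow>
      ('a, 'x) magma \<Rightarrow> ('x \<Rightarrow> ('a, 'b \<times> 'x) mterm set) \<Rightarrow>
      ('a, 'y) magma \<Rightarrow> ('y \<Rightarrow> ('a, 'b \<times> 'y) mterm set) \<Rightarrow> ('x \<Rightarrow> 'y) set" where
  "bimodel_map A B K \<delta> L \<epsilon> =
    {f \<in> magma_hom A K L. \<forall>x\<in>mcarrier K. \<epsilon> (f x) = copower_map A B K L f (\<delta> x)}"

text \<open>
  HOL cannot quantify over types inside a formula, so the type \<open>'k\<close> of the elements of the
  competing bimodels is a parameter.  A theorem concluding \<open>final_bimodel TYPE('k) A B L \<epsilon>\<close> with
  \<open>'k\<close> a free type variable asserts finality against bimodels over every type.
\<close>

definition final_bimodel ::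
    "'k itself \<Rightarrow> 'a set \<Rightarrow> 'b set \<Rightarrow>
      ('a, 'x) magma \<Rightarrow> ('x \<Rightarrow> ('a, 'b \<times> 'x) mterm set) \<Rightarrow> bool" where
  "final_bimodel _ A B L \<epsilon> \<longleftrightarrow>
    bimodel A B L \<epsilon> \<and>
    (\<forall>(K :: ('a, 'k) magma) \<delta>. bimodel A B K \<delta> \<longrightarrow> (\<exists>!f. f \<in> bimodel_map A B K \<delta> L \<epsilon>))"


section \<open>Continuous functions between stream spaces\<close>

definition streams_top :: "'a set \<Rightarrow> (nat \<Rightarrow> 'a) topology" where
  "streams_top A = product_topology (\<lambda>_. discrete_topology A) UNIV"

definition shift :: "(nat \<Rightarrow> 'a) \<Rightarrow> nat \<Rightarrow> 'a" where
  "shift x = (\<lambda>n. x (Suc n))"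

definition Top :: "'x topology \<Rightarrow> 'y topology \<Rightarrow> ('x \<Rightarrow> 'y) set" where
  "Top X Y = {f \<in> extensional (topspace X). continuous_map X Y f}"

definition split :: "'a set \<Rightarrow> ('a \<Rightarrow> (nat \<Rightarrow> 'a) \<Rightarrow> 'c) \<Rightarrow> (nat \<Rightarrow> 'a) \<Rightarrow> 'c" where
  "split A f = (\<lambda>x\<in>topspace (streams_top A). f (x 0) (shift x))"

definition Top_magma :: "'a set \<Rightarrow> 'c topology \<Rightarrow> ('a, (nat \<Rightarrow> 'a) \<Rightarrow> 'c) magma" where
  "Top_magma A C = \<lparr> mcarrier = Top (streams_top A) C, mop = split A \<rparr>"

definition E_magma :: "'a set \<Rightarrow> 'b set \<Rightarrow> ('a, (nat \<Rightarrow> 'a) \<Rightarrow> nat \<Rightarrow> 'b) magma" where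
  "E_magma A B = Top_magma A (streams_top B)"

definition copower_streams_top :: "'b set \<Rightarrow> ('b \<times> (nat \<Rightarrow> 'b)) topology" where
  "copower_streams_top B = sum_topology (\<lambda>_. streams_top B) B"

definition comparison ::
    "'a set \<Rightarrow> 'b set \<Rightarrow> ('a, 'b \<times> ((nat \<Rightarrow> 'a) \<Rightarrow> nat \<Rightarrow> 'b)) mterm set \<Rightarrow>
      (nat \<Rightarrow> 'a) \<Rightarrow> 'b \<times> (nat \<Rightarrow> 'b)" where
  "comparison A B =
    cotuple A B (\<lambda>_. E_magma A B) (Top_magma A (copower_streams_top B))
      (\<lambda>b. \<lambda>f\<in>Top (streams_top A) (streams_top B).
        compose (topspace (streams_top A)) (Pair b) f)"

definition stream_unfold :: "(nat \<Rightarrow> 'b) \<Rightarrow> 'b \<times> (nat \<Rightarrow> 'b)" where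
  "stream_unfold y = (y 0, shift y)"

definition E_delta ::
    "'a set \<Rightarrow> 'b set \<Rightarrow> ((nat \<Rightarrow> 'a) \<Rightarrow> nat \<Rightarrow> 'b) \<Rightarrow>
      ('a, 'b \<times> ((nat \<Rightarrow> 'a) \<Rightarrow> nat \<Rightarrow> 'b)) mterm set" where
  "E_delta A B =
    (\<lambda>f\<in>Top (streams_top A) (streams_top B).
      inv_into (mcarrier (copower A B (E_magma A B))) (comparison A B)
        (compose (topspace (streams_top A)) stream_unfold f))"

end

theory Submission
  imports Defs
begin

text \<open>
  The comparison map is injective because the operation of \<open>Top_magma A C\<close> is injective, so that
  terms with equal values can be compared level by level.  It is surjective because a continuous map
  outside its image would have a residual outside its image after every finite prefix of some stream
  \<open>w\<close>, whereas the \<open>B\<close>-component of the map is constant on a neighbourhood of \<open>w\<close>.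

  Given a bimodel \<open>(K, \<delta>)\<close>, the coordinates of a bimodel map \<open>f\<close> into continuous functions are
  forced: the head of \<open>f\<close> is the composite of \<open>\<delta>\<close> with the map \<open>B \<cdot> K \<rightarrow> Top(A\<^sup>\<nat>, B)\<close> sending the
  \<open>b\<close>-th summand to the constant \<open>b\<close>, and coordinate \<open>n + 1\<close> is the composite of \<open>\<delta>\<close> with the map
  that is coordinate \<open>n\<close> on each summand.  Conversely this recursion defines homomorphisms
  \<open>K \<rightarrow> Top(A\<^sup>\<nat>, B)\<close>, which assemble to a homomorphism into \<open>Top(A\<^sup>\<nat>, B\<^sup>\<nat>)\<close>.
\<close>

section \<open>Homomorphisms and coproducts\<close>

lemma magma_homD:
  assumes "h \<in> magma_hom A M N"
  shows "x \<in> mcarrier M \<Longrightarrow> h x \<in> mcarrier N"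
    and "f \<in> A \<rightarrow>\<^sub>E mcarrier M \<Longrightarrow> h (mop M f) = mop N (\<lambda>a\<in>A. h (f a))"
    and "h \<in> extensional (mcarrier M)"
  using assms by (auto simp: magma_hom_def PiE_iff)

lemma magma_homI:
  assumes "\<And>x. x \<in> mcarrier M \<Longrightarrow> h x \<in> mcarrier N"
    and "\<And>f. f \<in> A \<rightarrow>\<^sub>E mcarrier M \<Longrightarrow> h (mop M f) = mop N (\<lambda>a\<in>A. h (f a))"
    and "h \<in> extensional (mcarrier M)"
  shows "h \<in> magma_hom A M N"
  using assms by (auto simp: magma_hom_def PiE_iff)

lemma is_magmaD: "is_magma A M \<Longrightarrow> f \<in> A \<rightarrow>\<^sub>E mcarrier M \<Longrightarrow> mop M f \<in> mcarrier M"
  by (simp add: is_magma_def)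

lemma magma_hom_eqI:
  assumes "g \<in> magma_hom A M N" "h \<in> magma_hom A M N" "\<And>x. x \<in> mcarrier M \<Longrightarrow> g x = h x"
  shows "g = h"
  using magma_homD(3)[OF assms(1)] magma_homD(3)[OF assms(2)] assms(3) by (rule extensionalityI)

lemma magma_hom_compose:
  assumes K: "is_magma A K" and f: "f \<in> magma_hom A K L" and g: "g \<in> magma_hom A L M"
  shows "compose (mcarrier K) g f \<in> magma_hom A K M"
proof (rule magma_homI)
  fix F assume F: "F \<in> A \<rightarrow>\<^sub>E mcarrier K"
  have "(\<lambda>a\<in>A. f (F a)) \<in> A \<rightarrow>\<^sub>E mcarrier L"
    using F magma_homD(1)[OF f] by auto
  then have "g (f (mop K F)) = mop M (\<lambda>a\<in>A. g ((\<lambda>a\<in>A. f (F a)) a))"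
    by (simp add: magma_homD(2)[OF f F] magma_homD(2)[OF g])
  also have "(\<lambda>a\<in>A. g ((\<lambda>a\<in>A. f (F a)) a)) = (\<lambda>a\<in>A. compose (mcarrier K) g f (F a))"
    using F by (intro restrict_ext) (auto simp: compose_def)
  finally show "compose (mcarrier K) g f (mop K F) = mop M (\<lambda>a\<in>A. compose (mcarrier K) g f (F a))"
    using is_magmaD[OF K F] by (simp add: compose_eq restrict_def)
qed (auto simp: compose_def magma_homD(1)[OF f] magma_homD(1)[OF g])

text \<open>Since \<open>h\<close> sends \<open>mop M\<close> of the preimages to
  \<open>mop N F\<close>, injectivity identifies the preimage of \<open>mop N F\<close>; the same
  equation places \<open>mop N F\<close> in the carrier of \<open>N\<close>. The inverse is
  restricted because homomorphisms are extensional.\<close>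

lemma inv_into_magma_hom:
  assumes M: "is_magma A M" and h: "h \<in> magma_hom A M N"
    and bij: "bij_betw h (mcarrier M) (mcarrier N)"
  shows "restrict (inv_into (mcarrier M) h) (mcarrier N) \<in> magma_hom A N M"
proof (rule magma_homI)
  let ?k = "inv_into (mcarrier M) h"
  have k: "?k y \<in> mcarrier M" "h (?k y) = y" if "y \<in> mcarrier N" for y
    using that bij by (auto simp: bij_betw_def f_inv_into_f intro: inv_into_into)
  show "restrict ?k (mcarrier N) y \<in> mcarrier M" if "y \<in> mcarrier N" for y
    using that k by simp
  fix F assume F: "F \<in> A \<rightarrow>\<^sub>E mcarrier N"
  then have kF: "(\<lambda>a\<in>A. ?k (F a)) \<in> A \<rightarrow>\<^sub>E mcarrier M"
    using k by auto
  have "(\<lambda>a\<in>A. h ((\<lambda>a\<in>A. ?k (F a)) a)) = F"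
    using F k by (auto simp: fun_eq_iff PiE_iff extensional_def)
  then have hF: "h (mop M (\<lambda>a\<in>A. ?k (F a))) = mop N F"
    using magma_homD(2)[OF h kF] by simp
  have mF: "mop M (\<lambda>a\<in>A. ?k (F a)) \<in> mcarrier M"
    using M kF by (auto simp: is_magma_def)
  then have "mop N F \<in> mcarrier N"
    using magma_homD(1)[OF h] hF by metis
  moreover have "?k (mop N F) = mop M (\<lambda>a\<in>A. ?k (F a))"
    using hF mF bij by (metis bij_betw_def inv_into_f_f)
  moreover have "(\<lambda>a\<in>A. ?k (F a)) = (\<lambda>a\<in>A. restrict ?k (mcarrier N) (F a))"
    using F by (intro restrict_ext) auto
  ultimately show "restrict ?k (mcarrier N) (mop N F) =
      mop M (\<lambda>a\<in>A. restrict ?k (mcarrier N) (F a))"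
    by simp
qed simp

section \<open>Cotuples, uniqueness and induction for coproducts of magmas\<close>

lemma cotuple_hom:
  assumes "\<forall>b\<in>B. is_magma A (M b)" "is_magma A N" "\<forall>b\<in>B. h b \<in> magma_hom A (M b) N"
  shows "cotuple A B M N h \<in> magma_hom A (coprod A B M) N"
  using theI'[OF coprod_universal[OF assms]] by (simp add: cotuple_def)

lemma cotuple_coprod_inj:
  assumes "\<forall>b\<in>B. is_magma A (M b)" "is_magma A N" "\<forall>b\<in>B. h b \<in> magma_hom A (M b) N"
    and "b \<in> B" "x \<in> mcarrier (M b)"
  shows "cotuple A B M N h (coprod_inj A B M b x) = h b x"
  using theI'[OF coprod_universal[OF assms(1-3)]] assms(4,5) by (simp add: cotuple_def)

text \<open>Both maps mediate the cocone that \<open>h\<close> induces on the summands, so the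
  uniqueness half of the universal property applies.\<close>

lemma coprod_hom_eqI:
  assumes M: "\<forall>b\<in>B. is_magma A (M b)" and N: "is_magma A N"
    and g: "g \<in> magma_hom A (coprod A B M) N" and h: "h \<in> magma_hom A (coprod A B M) N"
    and eq: "\<And>b x. b \<in> B \<Longrightarrow> x \<in> mcarrier (M b) \<Longrightarrow>
      g (coprod_inj A B M b x) = h (coprod_inj A B M b x)"
  shows "g = h"
proof -
  let ?k = "\<lambda>b. compose (mcarrier (M b)) h (coprod_inj A B M b)"
  have k: "\<forall>b\<in>B. ?k b \<in> magma_hom A (M b) N"
    using magma_hom_compose[OF _ coprod_inj_hom[OF M] h] M by blast
  show ?thesis
    by (rule ex1E[OF coprod_universal[OF M N k]]) (metis (no_types, lifting) compose_eq eq g h)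
qed

text \<open>Term induction carried over to congruence classes: the class of a generator is an
  injected element, and the class of \<open>Op f\<close> is the operation applied to the classes of
  the \<open>f a\<close>. Later arguments need not mention terms again.\<close>

lemma coprod_induct [consumes 2, case_names inj mop]:
  assumes M: "\<forall>b\<in>B. is_magma A (M b)" and z: "z \<in> mcarrier (coprod A B M)"
    and inj: "\<And>b x. b \<in> B \<Longrightarrow> x \<in> mcarrier (M b) \<Longrightarrow> P (coprod_inj A B M b x)"
    and mop: "\<And>F. F \<in> A \<rightarrow>\<^sub>E mcarrier (coprod A B M) \<Longrightarrow> (\<And>a. a \<in> A \<Longrightarrow> P (F a)) \<Longrightarrow>
      P (mop (coprod A B M) F)"
  shows "P z"
proof -
  let ?R = "coprod_cong A B M"
  have "P (?R `` {t})" if "t \<in> coprod_terms A B M" for t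
    using that
  proof induction
    case (Gen g)
    then show ?case
      using inj[of "fst g" "snd g"] by (auto simp: coprod_inj_def)
  next
    case (Op f)
    let ?F = "\<lambda>a\<in>A. ?R `` {f a}"
    have "mop (coprod A B M) ?F = ?R `` {Op (restrict f A)}"
      using Op by (intro coprod_mop_class[OF M]) auto
    moreover have "P (mop (coprod A B M) ?F)"
      using Op by (intro mop) (auto simp: coprod_def intro: quotientI)
    ultimately show ?case
      using Op.hyps by (simp add: extensional_restrict)
  qed
  then show ?thesis
    using z by (auto simp: coprod_def quotient_def)
qed

lemma is_magma_copower: "is_magma A K \<Longrightarrow> is_magma A (copower A B K)"
  by (simp add: copower_def is_magma_coprod)

section \<open>Magmas of continuous maps on streams\<close>

lemma topspace_streams_top: "topspace (streams_top A) = {x. \<forall>n. x n \<in> A}"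
  by (auto simp: streams_top_def)

lemma continuous_map_streams_top:
  "continuous_map X (streams_top A) f \<longleftrightarrow>
    (\<forall>n. continuous_map X (discrete_topology A) (\<lambda>x. f x n))"
  by (simp add: streams_top_def continuous_map_componentwise_UNIV)

lemma continuous_map_nth: "continuous_map (streams_top A) (discrete_topology A) (\<lambda>x. x n)"
  using continuous_map_streams_top[of "streams_top A" A "\<lambda>x. x"] by simp

lemma continuous_map_shift: "continuous_map (streams_top A) (streams_top A) shift"
  by (simp add: continuous_map_streams_top shift_def continuous_map_nth)

lemma continuous_map_case_nat:
  "a \<in> A \<Longrightarrow> continuous_map (streams_top A) (streams_top A) (case_nat a)"
  unfolding continuous_map_streams_top
proof
  fix n
  assume "a \<in> A"
  then show "continuous_map (streams_top A) (discrete_topology A) (\<lambda>x. case_nat a x n)"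
    by (cases n) (simp_all add: continuous_map_nth)
qed

lemma case_nat_shift: "case_nat (x 0) (shift x) = x"
  by (auto simp: fun_eq_iff shift_def split: nat.split)

lemma shift_case_nat: "shift (case_nat a x) = x"
  by (simp add: shift_def)

lemma topspace_copower_streams_top:
  "topspace (copower_streams_top B) = B \<times> topspace (streams_top B)"
  by (auto simp: copower_streams_top_def)

text \<open>The preimage of \<open>U\<close> is a union over the heads \<open>b\<close>: streams
  starting with \<open>b\<close>, intersected with the \<open>shift\<close>-preimage of the slice of
  \<open>U\<close> at \<open>b\<close>. Both sets are open.\<close>

lemma continuous_map_stream_unfold:
  "continuous_map (streams_top B) (copower_streams_top B) stream_unfold"
  unfolding continuous_map_def
proof (intro conjI allI impI)
  let ?S = "streams_top B"
  show "stream_unfold \<in> topspace ?S \<rightarrow> topspace (copower_streams_top B)"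
    by (auto simp: topspace_copower_streams_top topspace_streams_top stream_unfold_def shift_def)
  fix U assume U: "openin (copower_streams_top B) U"
  have "openin ?S {y \<in> topspace ?S. y 0 \<in> {b}}" if "b \<in> B" for b
    using that by (intro openin_continuous_map_preimage[OF continuous_map_nth]) auto
  moreover have "openin ?S {y \<in> topspace ?S. shift y \<in> {z. (b, z) \<in> U}}" if "b \<in> B" for b
    using that U by (intro openin_continuous_map_preimage[OF continuous_map_shift])
      (auto simp: copower_streams_top_def openin_sum_topology)
  ultimately have "openin ?S (\<Union>b\<in>B.
      {y \<in> topspace ?S. y 0 \<in> {b}} \<inter> {y \<in> topspace ?S. shift y \<in> {z. (b, z) \<in> U}})"
    by blast
  also have "(\<Union>b\<in>B.
      {y \<in> topspace ?S. y 0 \<in> {b}} \<inter> {y \<in> topspace ?S. shift y \<in> {z. (b, z) \<in> U}}) =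
      {y \<in> topspace ?S. stream_unfold y \<in> U}"
    by (auto simp: stream_unfold_def topspace_streams_top)
  finally show "openin ?S {y \<in> topspace ?S. stream_unfold y \<in> U}" .
qed

lemma continuous_map_from_copower_streams_top:
  assumes "\<And>b. b \<in> B \<Longrightarrow> continuous_map (streams_top B) C (\<lambda>y. f (b, y))"
  shows "continuous_map (copower_streams_top B) C f"
  unfolding continuous_map_def
proof (intro conjI allI impI)
  show "f \<in> topspace (copower_streams_top B) \<rightarrow> topspace C"
    using assms by (auto simp: topspace_copower_streams_top continuous_map_def Pi_iff)
  fix U assume "openin C U"
  then have "openin (streams_top B) {y \<in> topspace (streams_top B). f (b, y) \<in> U}" if "b \<in> B" for b
    using assms[OF that] by (simp add: continuous_map_def)
  then show "openin (copower_streams_top B) {p \<in> topspace (copower_streams_top B). f p \<in> U}"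
    by (auto simp: copower_streams_top_def openin_sum_topology)
qed

section \<open>The operation \<open>split\<close> on continuous maps\<close>

lemma Top_magma_simps:
  "mcarrier (Top_magma A C) = Top (streams_top A) C" "mop (Top_magma A C) = split A"
  "mcarrier (E_magma A B) = Top (streams_top A) (streams_top B)" "mop (E_magma A B) = split A"
  by (simp_all add: Top_magma_def E_magma_def)

lemma Top_restrictI:
  "continuous_map X Y f \<Longrightarrow> restrict f (topspace X) \<in> Top X Y"
  by (auto simp: Top_def intro: continuous_map_eq)

lemma Top_composeI:
  "f \<in> Top X Y \<Longrightarrow> continuous_map Y Z g \<Longrightarrow> compose (topspace X) g f \<in> Top X Z"
  unfolding compose_def using continuous_map_compose[of X Y f Z g]
  by (intro Top_restrictI) (simp add: Top_def o_def)

lemma Top_eqI: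
  "f \<in> Top X Y \<Longrightarrow> g \<in> Top X Z \<Longrightarrow> (\<And>x. x \<in> topspace X \<Longrightarrow> f x = g x) \<Longrightarrow> f = g"
  by (auto simp: Top_def intro: extensionalityI)

text \<open>\<open>split A F\<close> is the uncurried family, continuous on the coproduct of
  \<open>A\<close> copies of the stream space, composed with \<open>stream_unfold\<close>. Here
  \<open>copower_streams_top\<close> is indexed by \<open>A\<close> rather than
  \<open>B\<close>.\<close>

lemma is_magma_Top_magma: "is_magma A (Top_magma A C)"
  unfolding is_magma_def Top_magma_simps
proof
  fix F assume F: "F \<in> A \<rightarrow>\<^sub>E Top (streams_top A) C"
  have "continuous_map (copower_streams_top A) C (\<lambda>(a, x). F a x)"
    using F by (intro continuous_map_from_copower_streams_top) (auto simp: Top_def)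
  from continuous_map_compose[OF continuous_map_stream_unfold this]
  show "split A F \<in> Top (streams_top A) C"
    unfolding split_def by (intro Top_restrictI) (simp add: o_def stream_unfold_def)
qed

lemma is_magma_E_magma: "is_magma A (E_magma A B)"
  by (simp add: E_magma_def is_magma_Top_magma)

text \<open>The functorial action of maps out of the stream space. The summands of the comparison
  map, the unfolding of values and all coordinate projections are instances, so a single
  homomorphism proof serves them all.\<close>

definition postcomp :: "'a set \<Rightarrow> 'c topology \<Rightarrow> ('c \<Rightarrow> 'd) \<Rightarrow>
    ((nat \<Rightarrow> 'a) \<Rightarrow> 'c) \<Rightarrow> (nat \<Rightarrow> 'a) \<Rightarrow> 'd" where
  "postcomp A C p = (\<lambda>f\<in>Top (streams_top A) C. compose (topspace (streams_top A)) p f)"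

lemma postcomp_apply:
  "f \<in> Top (streams_top A) C \<Longrightarrow> x \<in> topspace (streams_top A) \<Longrightarrow> postcomp A C p f x = p (f x)"
  by (simp add: postcomp_def compose_def)

text \<open>\<open>split\<close> rearranges arguments while \<open>p\<close> acts on values, so the
  two commute.\<close>

lemma postcomp_hom:
  assumes "continuous_map C D p"
  shows "postcomp A C p \<in> magma_hom A (Top_magma A C) (Top_magma A D)"
proof (rule magma_homI)
  show "postcomp A C p f \<in> mcarrier (Top_magma A D)" if "f \<in> mcarrier (Top_magma A C)" for f
    using that assms by (simp add: Top_magma_simps postcomp_def Top_composeI)
  fix F assume F: "F \<in> A \<rightarrow>\<^sub>E mcarrier (Top_magma A C)"
  then have "mop (Top_magma A C) F \<in> mcarrier (Top_magma A C)"
    using is_magma_Top_magma by (auto simp: is_magma_def)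
  moreover have "F (x 0) \<in> Top (streams_top A) C" "shift x \<in> topspace (streams_top A)" "x 0 \<in> A"
    if "x \<in> topspace (streams_top A)" for x
    using F that by (auto simp: Top_magma_simps topspace_streams_top shift_def)
  ultimately show "postcomp A C p (mop (Top_magma A C) F) =
      mop (Top_magma A D) (\<lambda>a\<in>A. postcomp A C p (F a))"
    by (auto simp: Top_magma_simps postcomp_def compose_def split_def fun_eq_iff)
qed (simp add: postcomp_def Top_magma_simps)

lemma postcomp_Top:
  "continuous_map C D p \<Longrightarrow> f \<in> Top (streams_top A) C \<Longrightarrow> postcomp A C p f \<in> Top (streams_top A) D"
  by (simp add: postcomp_def Top_composeI)

text \<open>The derivative of \<open>f\<close> by the letter \<open>a\<close>: what remains of
  \<open>f\<close> once \<open>a\<close> has been read. The family of all residuals inverts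
  \<open>split\<close>.\<close>

definition residual :: "'a set \<Rightarrow> 'a \<Rightarrow> ((nat \<Rightarrow> 'a) \<Rightarrow> 'c) \<Rightarrow> (nat \<Rightarrow> 'a) \<Rightarrow> 'c" where
  "residual A a f = (\<lambda>x\<in>topspace (streams_top A). f (case_nat a x))"

lemma case_nat_in_streams:
  "a \<in> A \<Longrightarrow> x \<in> topspace (streams_top A) \<Longrightarrow> case_nat a x \<in> topspace (streams_top A)"
  by (auto simp: topspace_streams_top split: nat.split)

lemma residual_Top:
  assumes "f \<in> Top (streams_top A) C" "a \<in> A"
  shows "residual A a f \<in> Top (streams_top A) C"
  unfolding residual_def
  using continuous_map_compose[OF continuous_map_case_nat[OF assms(2)], of C f] assms(1)
  by (intro Top_restrictI) (simp add: Top_def o_def)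

lemma split_residual:
  assumes "f \<in> Top (streams_top A) C"
  shows "split A (\<lambda>a\<in>A. residual A a f) = f"
proof (rule extensionalityI[of _ "topspace (streams_top A)"])
  show "f \<in> extensional (topspace (streams_top A))"
    using assms by (simp add: Top_def)
  fix x assume "x \<in> topspace (streams_top A)"
  then show "split A (\<lambda>a\<in>A. residual A a f) x = f x"
    by (auto simp: split_def residual_def topspace_streams_top shift_def
        case_nat_shift[unfolded shift_def])
qed (simp add: split_def)

lemma residual_split:
  assumes "F \<in> A \<rightarrow>\<^sub>E Top (streams_top A) C" "a \<in> A"
  shows "residual A a (split A F) = F a"
proof (rule extensionalityI[of _ "topspace (streams_top A)"])
  show "F a \<in> extensional (topspace (streams_top A))"
    using assms by (auto simp: Top_def)
qed (use assms in \<open>auto simp: split_def residual_def shift_case_nat case_nat_in_streams\<close>)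

lemma split_inject:
  assumes "F \<in> A \<rightarrow>\<^sub>E Top (streams_top A) C" "G \<in> A \<rightarrow>\<^sub>E Top (streams_top A) C"
    and "split A F = split A G"
  shows "F = G"
  by (rule PiE_ext[OF assms(1,2)]) (metis assms residual_split)

text \<open>A basic open neighbourhood of \<open>w\<close> constrains only finitely many
  coordinates, and \<open>n\<close> is a strict bound for their indices.\<close>

lemma openin_streams_top_prefix:
  assumes "openin (streams_top A) U" "w \<in> U"
  obtains n where "\<And>x. x \<in> topspace (streams_top A) \<Longrightarrow> (\<And>i. i < n \<Longrightarrow> x i = w i) \<Longrightarrow> x \<in> U"
proof -
  obtain V where V: "finite {i. V i \<noteq> A}" "w \<in> Pi\<^sub>E UNIV V" "Pi\<^sub>E UNIV V \<subseteq> U"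
    using assms unfolding streams_top_def openin_product_topology_alt by auto
  obtain n where n: "\<And>i. V i \<noteq> A \<Longrightarrow> i < n"
    using V(1)[unfolded finite_nat_set_iff_bounded] by auto
  show thesis
  proof
    fix x assume x: "x \<in> topspace (streams_top A)" "\<And>i. i < n \<Longrightarrow> x i = w i"
    have "x i \<in> V i" for i
      using x V(2) n[of i] by (cases "V i = A") (auto simp: topspace_streams_top PiE_iff)
    then show "x \<in> U"
      using V(3) by auto
  qed
qed

text \<open>Bar induction: continuity into a discrete set bounds the depth along each stream.\<close>

lemma locally_constant_induct [consumes 2, case_names const split]:
  assumes f: "f \<in> Top (streams_top A) C" and p: "continuous_map C (discrete_topology B) p"
    and const: "\<And>f b. f \<in> Top (streams_top A) C \<Longrightarrow> b \<in> B \<Longrightarrow>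
      (\<And>x. x \<in> topspace (streams_top A) \<Longrightarrow> p (f x) = b) \<Longrightarrow> P f"
    and split: "\<And>F. F \<in> A \<rightarrow>\<^sub>E Top (streams_top A) C \<Longrightarrow> (\<And>a. a \<in> A \<Longrightarrow> P (F a)) \<Longrightarrow>
      P (split A F)"
  shows "P f"
proof (rule ccontr)
  assume "\<not> P f"
  let ?Q = "\<lambda>f. f \<in> Top (streams_top A) C \<and> \<not> P f"
  \<comment> \<open>If no residual of \<open>g\<close> were a counterexample, \<open>g\<close> would
    not be one either, being the \<open>split\<close> of its residuals.\<close>
  have step: "\<exists>a\<in>A. ?Q (residual A a g)" if g: "?Q g" for g
  proof (rule ccontr)
    assume "\<not> (\<exists>a\<in>A. ?Q (residual A a g))"
    then have "P (split A (\<lambda>a\<in>A. residual A a g))"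
      using residual_Top[of g A C] g by (intro split) auto
    then show False
      using g split_residual[of g A C] by simp
  qed
  \<comment> \<open>Dependent choice yields an infinite path of counterexamples; the clause for
    index \<open>0\<close> pins its start to \<open>f\<close>.\<close>
  obtain s where s0: "s 0 = f" and s: "\<And>n. ?Q (s n)"
      and sSuc: "\<And>n. \<exists>a\<in>A. s (Suc n) = residual A a (s n)"
    using dependent_nat_choice[of "\<lambda>n g. ?Q g \<and> (n = 0 \<longrightarrow> g = f)"
        "\<lambda>n g g'. \<exists>a\<in>A. g' = residual A a g"]
      step f \<open>\<not> P f\<close> by (metis (lifting) nat.simps(3))
  from sSuc obtain w where w: "\<And>n. w n \<in> A" and sw: "\<And>n. s (Suc n) = residual A (w n) (s n)"
    by metis
  have ws: "w \<in> topspace (streams_top A)"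
    using w by (simp add: topspace_streams_top)
  \<comment> \<open>\<open>s n\<close> is \<open>f\<close> after the first \<open>n\<close> letters
    of \<open>w\<close> have been read.\<close>
  have pre: "s n x = f (\<lambda>i. if i < n then w i else x (i - n))"
    if "x \<in> topspace (streams_top A)" for n x
    using that
  proof (induction n arbitrary: x)
    case (Suc n)
    have "s (Suc n) x = s n (case_nat (w n) x)"
      using Suc.prems by (simp add: sw residual_def)
    also have "\<dots> = f (\<lambda>i. if i < n then w i else case_nat (w n) x (i - n))"
      by (rule Suc.IH[OF case_nat_in_streams[OF w Suc.prems]])
    also have "(\<lambda>i. if i < n then w i else case_nat (w n) x (i - n)) =
        (\<lambda>i. if i < Suc n then w i else x (i - Suc n))"
    proof
      fix i
      \<comment> \<open>At \<open>i = n\<close> the letter \<open>w n\<close> just prepended is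
        read; beyond it, \<open>case_nat\<close> drops one from the index.\<close>
      consider "i < n" | "i = n" | "i - n = Suc (i - Suc n)" "n < i"
        by linarith
      then show "(if i < n then w i else case_nat (w n) x (i - n)) =
          (if i < Suc n then w i else x (i - Suc n))"
        by cases auto
    qed
    finally show ?case .
  qed (simp add: s0)
  \<comment> \<open>The value along the path itself: continuity makes \<open>p\<close> after
    \<open>f\<close> equal to \<open>b\<close> on all streams sharing some prefix with
    \<open>w\<close>, so that some \<open>s n\<close> falls under \<open>const\<close>.\<close>
  define b where "b = p (f w)"
  have pf: "continuous_map (streams_top A) (discrete_topology B) (\<lambda>x. p (f x))"
    using f p continuous_map_compose[of _ C f _ p] by (simp add: Top_def o_def)
  have b: "b \<in> B"
    using pf ws by (auto simp: b_def continuous_map_def)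
  let ?U = "{x \<in> topspace (streams_top A). p (f x) \<in> {b}}"
  have U: "openin (streams_top A) ?U"
    using b by (intro openin_continuous_map_preimage[OF pf]) auto
  have wU: "w \<in> ?U"
    using ws by (simp add: b_def)
  obtain n where n: "\<And>x. x \<in> topspace (streams_top A) \<Longrightarrow> (\<And>i. i < n \<Longrightarrow> x i = w i) \<Longrightarrow> x \<in> ?U"
    by (rule openin_streams_top_prefix[OF U wU]) blast
  have "p (s n x) = b" if "x \<in> topspace (streams_top A)" for x
  proof -
    have "(\<lambda>i. if i < n then w i else x (i - n)) \<in> ?U"
      using that w by (intro n) (auto simp: topspace_streams_top)
    then show ?thesis
      by (simp add: pre[OF that])
  qed
  then have "P (s n)"
    using const[OF _ b] s by blast
  then show False
    using s by blast
qed

section \<open>The comparison isomorphism\<close>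

lemma continuous_map_Pair_copower:
  "b \<in> B \<Longrightarrow> continuous_map (streams_top B) (copower_streams_top B) (Pair b)"
  unfolding copower_streams_top_def by (rule continuous_map_component_injection)

lemma continuous_map_fst_copower:
  "continuous_map (copower_streams_top B) (discrete_topology B) fst"
  by (rule continuous_map_from_copower_streams_top) simp

lemma continuous_map_snd_copower:
  "continuous_map (copower_streams_top B) (streams_top B) snd"
  by (rule continuous_map_from_copower_streams_top) simp

lemma continuous_map_snd_nth_copower:
  "continuous_map (copower_streams_top B) (discrete_topology B) (\<lambda>p. snd p n)"
  using continuous_map_snd_copower[of B] by (simp add: continuous_map_streams_top)

lemma postcomp_Pair_hom:
  "\<forall>b\<in>B. postcomp A (streams_top B) (Pair b) \<in>
    magma_hom A (E_magma A B) (Top_magma A (copower_streams_top B))"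
  using postcomp_hom[OF continuous_map_Pair_copower] by (auto simp: E_magma_def)

lemma comparison_eq_cotuple:
  "comparison A B = cotuple A B (\<lambda>_. E_magma A B) (Top_magma A (copower_streams_top B))
    (\<lambda>b. postcomp A (streams_top B) (Pair b))"
  by (simp add: comparison_def postcomp_def)

lemma comparison_hom:
  "comparison A B \<in>
    magma_hom A (copower A B (E_magma A B)) (Top_magma A (copower_streams_top B))"
  unfolding comparison_eq_cotuple copower_def
  by (rule cotuple_hom) (simp_all add: is_magma_E_magma is_magma_Top_magma postcomp_Pair_hom)

lemma comparison_coprod_inj:
  assumes "b \<in> B" "f \<in> Top (streams_top A) (streams_top B)"
  shows "comparison A B (coprod_inj A B (\<lambda>_. E_magma A B) b f) =
    postcomp A (streams_top B) (Pair b) f"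
  unfolding comparison_eq_cotuple
  by (rule cotuple_coprod_inj)
    (simp_all add: is_magma_E_magma is_magma_Top_magma postcomp_Pair_hom Top_magma_simps assms)

text \<open>Unfolds a generator into an operation applied to generators, so that it can be compared
  with an element built by the operation.\<close>

lemma coprod_inj_E_split:
  assumes "b \<in> B" "F \<in> A \<rightarrow>\<^sub>E Top (streams_top A) (streams_top B)"
  shows "coprod_inj A B (\<lambda>_. E_magma A B) b (split A F) =
    mop (copower A B (E_magma A B)) (\<lambda>a\<in>A. coprod_inj A B (\<lambda>_. E_magma A B) b (F a))"
  using magma_homD(2)[OF coprod_inj_hom[of B A "\<lambda>_. E_magma A B" b], of F] assms
  by (simp add: is_magma_E_magma Top_magma_simps copower_def)

text \<open>Injectivity when one of the two elements is a generator. Induction on \<open>z\<close>: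
  two generators are compared by evaluation at a stream; against an operation, the generator is
  unfolded through the residuals of \<open>f\<close>, and injectivity of \<open>split\<close> passes
  to the arguments.\<close>

lemma comparison_eq_postcomp_Pair:
  assumes "z \<in> mcarrier (copower A B (E_magma A B))"
    and "b \<in> B" "f \<in> Top (streams_top A) (streams_top B)"
    and "comparison A B z = postcomp A (streams_top B) (Pair b) f"
  shows "z = coprod_inj A B (\<lambda>_. E_magma A B) b f"
proof -
  let ?E = "E_magma A B" and ?S = "streams_top A"
  have E: "\<forall>b\<in>B. is_magma A ?E"
    by (simp add: is_magma_E_magma)
  show ?thesis
    using E assms(1)[unfolded copower_def] assms(3,4)
  proof (induction arbitrary: f rule: coprod_induct)
    case (inj b' f')
    have f': "f' \<in> Top ?S (streams_top B)"
      using inj by (simp add: Top_magma_simps)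
    have eq: "(b', f' x) = (b, f x)" if "x \<in> topspace ?S" for x
      using inj(4) that inj f' comparison_coprod_inj[OF inj(1) f'] postcomp_apply by metis
    show ?case
    proof (cases "A = {}")
      case False
      then obtain a where "a \<in> A"
        by blast
      \<comment> \<open>A constant stream shows that the domain is inhabited; evaluating there
        forces the summands \<open>b'\<close> and \<open>b\<close> to agree.\<close>
      then have "(\<lambda>_. a) \<in> topspace ?S"
        by (simp add: topspace_streams_top)
      then show ?thesis
        using eq Top_eqI[OF f' inj(3)] by simp
    next
      case True
      \<comment> \<open>All the generators coincide with the value of the nullary operation.\<close>
      let ?u = "\<lambda>_. undefined :: (nat \<Rightarrow> 'a) \<Rightarrow> nat \<Rightarrow> 'b"
      have u: "?u \<in> A \<rightarrow>\<^sub>E Top ?S (streams_top B)" and "topspace ?S = {}"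
        using True by (auto simp: topspace_streams_top)
      then have "f = split A ?u" "f' = split A ?u"
        using inj(3) f' by (auto simp: split_def Top_def)
      then show ?thesis
        using coprod_inj_E_split[OF inj(1) u] coprod_inj_E_split[OF assms(2) u] True
        by (simp add: restrict_def)
    qed
  next
    case (mop F)
    let ?G = "\<lambda>a\<in>A. residual A a f"
    let ?p = "postcomp A (streams_top B) (Pair b)"
    have G: "?G \<in> A \<rightarrow>\<^sub>E Top ?S (streams_top B)"
      using residual_Top[OF mop(3)] by auto
    have cF: "(\<lambda>a\<in>A. comparison A B (F a)) \<in> A \<rightarrow>\<^sub>E Top ?S (copower_streams_top B)"
      using mop(1) magma_homD(1)[OF comparison_hom, of _ A B]
      by (auto simp: copower_def Top_magma_simps)
    have pG: "(\<lambda>a\<in>A. ?p (?G a)) \<in> A \<rightarrow>\<^sub>E Top ?S (copower_streams_top B)"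
      using postcomp_Top[OF continuous_map_Pair_copower[OF assms(2)] residual_Top[OF mop(3)]]
      by auto
    have "split A (\<lambda>a\<in>A. comparison A B (F a)) = ?p f"
      using mop(4) magma_homD(2)[OF comparison_hom, of F A B] mop(1)
      by (simp add: Top_magma_simps copower_def)
    also have "\<dots> = ?p (split A ?G)"
      using split_residual[OF mop(3)] by simp
    also have "\<dots> = split A (\<lambda>a\<in>A. ?p (?G a))"
      using magma_homD(2)[OF postcomp_Pair_hom[rule_format, OF assms(2)], of ?G A] G
      by (simp add: Top_magma_simps)
    finally have eq: "(\<lambda>a\<in>A. comparison A B (F a)) = (\<lambda>a\<in>A. ?p (?G a))"
      using split_inject[OF cF pG] by blast
    \<comment> \<open>The induction hypothesis is used at a residual of \<open>f\<close>, which is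
      why \<open>f\<close> is generalized in the induction.\<close>
    have "F a = coprod_inj A B (\<lambda>_. ?E) b (?G a)" if "a \<in> A" for a
      using mop(2)[OF that, of "?G a"] G that fun_cong[OF eq, of a] by auto
    then have "F = (\<lambda>a\<in>A. coprod_inj A B (\<lambda>_. ?E) b (?G a))"
      using mop(1) by (auto simp: fun_eq_iff PiE_iff extensional_def)
    then show ?case
      using coprod_inj_E_split[OF assms(2) G] split_residual[OF mop(3)] by (simp add: copower_def)
  qed
qed

text \<open>Nested induction on \<open>z\<close> and \<open>w\<close>. If either is a generator, the
  preceding lemma applies, with the roles exchanged in the inner generator case. If both are
  operations, injectivity of \<open>split\<close> reduces to the arguments.\<close>

lemma inj_on_comparison:
  "inj_on (comparison A B) (mcarrier (copower A B (E_magma A B)))"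
proof (rule inj_onI)
  let ?E = "E_magma A B"
  have E: "\<forall>b\<in>B. is_magma A ?E"
    by (simp add: is_magma_E_magma)
  fix z w
  assume z: "z \<in> mcarrier (copower A B ?E)" and w: "w \<in> mcarrier (copower A B ?E)"
    and eq: "comparison A B z = comparison A B w"
  show "z = w"
    using E z[unfolded copower_def] w eq
  proof (induction arbitrary: w rule: coprod_induct)
    case (inj b f)
    then show ?case
      using comparison_eq_postcomp_Pair[of w A B b f] comparison_coprod_inj[of b B f A]
      by (simp add: Top_magma_simps)
  next
    case (mop F)
    note IH = mop(2)
    have F: "F \<in> A \<rightarrow>\<^sub>E mcarrier (copower A B ?E)"
      using mop(1) by (simp add: copower_def)
    have val: "comparison A B (mop (copower A B ?E) H) = split A (\<lambda>a\<in>A. comparison A B (H a))"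
        "(\<lambda>a\<in>A. comparison A B (H a)) \<in> A \<rightarrow>\<^sub>E Top (streams_top A) (copower_streams_top B)"
      if "H \<in> A \<rightarrow>\<^sub>E mcarrier (copower A B ?E)" for H
      using that magma_homD(1,2)[OF comparison_hom, of _ A B]
      by (auto simp: Top_magma_simps)
    have Fc: "mop (copower A B ?E) F \<in> mcarrier (copower A B ?E)"
      by (rule is_magmaD[OF is_magma_copower[OF is_magma_E_magma] F])
    show ?case
      using E mop(3)[unfolded copower_def] mop(4)
    proof (induction rule: coprod_induct)
      case (inj b g)
      then show ?case
        using comparison_eq_postcomp_Pair[OF Fc, of b g] comparison_coprod_inj[of b B g A]
        by (auto simp: Top_magma_simps copower_def)
    next
      case (mop G)
      then have G: "G \<in> A \<rightarrow>\<^sub>E mcarrier (copower A B ?E)"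
        by (simp add: copower_def)
      have "(\<lambda>a\<in>A. comparison A B (F a)) = (\<lambda>a\<in>A. comparison A B (G a))"
        using val[OF F] val[OF G] mop by (intro split_inject) (auto simp: copower_def)
      then have "F a = G a" if "a \<in> A" for a
        using that IH G by (metis PiE_mem restrict_apply')
      then show ?case
        using F G by (metis PiE_ext)
    qed
  qed
qed

text \<open>Surjectivity is bar induction along the summand label \<open>fst\<close>. A map with
  constant label \<open>b\<close> comes from its second component in summand \<open>b\<close>; for a
  \<open>split\<close>, preimages of the pieces are chosen and combined by the operation.\<close>

lemma bij_betw_comparison:
  "bij_betw (comparison A B) (mcarrier (copower A B (E_magma A B)))
    (Top (streams_top A) (copower_streams_top B))"
proof (rule bij_betw_imageI[OF inj_on_comparison])
  let ?E = "E_magma A B" and ?S = "streams_top A"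
  let ?Im = "comparison A B ` mcarrier (copower A B ?E)"
  show "?Im = Top ?S (copower_streams_top B)"
  proof (intro equalityI subsetI)
    show "f \<in> Top ?S (copower_streams_top B)" if "f \<in> ?Im" for f
      using that magma_homD(1)[OF comparison_hom] by (auto simp: Top_magma_simps)
    show "f \<in> ?Im" if "f \<in> Top ?S (copower_streams_top B)" for f
      using that continuous_map_fst_copower
    proof (induction rule: locally_constant_induct)
      case (const f b)
      let ?g = "postcomp A (copower_streams_top B) snd f"
      have g: "?g \<in> Top ?S (streams_top B)"
        by (rule postcomp_Top[OF continuous_map_snd_copower const(1)])
      have "postcomp A (streams_top B) (Pair b) ?g = f"
        using const by (intro Top_eqI[OF postcomp_Top[OF continuous_map_Pair_copower g] const(1)])
          (auto simp: postcomp_apply g prod_eq_iff)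
      moreover have "coprod_inj A B (\<lambda>_. ?E) b ?g \<in> mcarrier (copower A B ?E)"
        using magma_homD(1)[OF coprod_inj_hom[of B A "\<lambda>_. ?E" b]] g const(2)
        by (simp add: is_magma_E_magma Top_magma_simps copower_def)
      ultimately show ?case
        using comparison_coprod_inj[OF const(2) g] by (metis imageI)
    next
      case (split F)
      then have "\<forall>a\<in>A. \<exists>g. g \<in> mcarrier (copower A B ?E) \<and> F a = comparison A B g"
        by blast
      then obtain G where G: "\<And>a. a \<in> A \<Longrightarrow> G a \<in> mcarrier (copower A B ?E)"
          "\<And>a. a \<in> A \<Longrightarrow> F a = comparison A B (G a)"
        by metis
      have rG: "restrict G A \<in> A \<rightarrow>\<^sub>E mcarrier (copower A B ?E)"
        using G by auto
      have "(\<lambda>a\<in>A. comparison A B (restrict G A a)) = F"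
        using G split(1) by (auto simp: fun_eq_iff PiE_iff extensional_def)
      then have "comparison A B (mop (copower A B ?E) (restrict G A)) = split A F"
        using magma_homD(2)[OF comparison_hom rG] by (simp add: Top_magma_simps)
      moreover have "mop (copower A B ?E) (restrict G A) \<in> mcarrier (copower A B ?E)"
        by (rule is_magmaD[OF is_magma_copower[OF is_magma_E_magma] rG])
      ultimately show ?case
        by (metis imageI)
    qed
  qed
qed

section \<open>The bimodel structure on the continuous stream functions\<close>

lemma stream_unfold_hom:
  "postcomp A (streams_top B) stream_unfold \<in>
    magma_hom A (E_magma A B) (Top_magma A (copower_streams_top B))"
  unfolding E_magma_def by (rule postcomp_hom[OF continuous_map_stream_unfold])

text \<open>A composite of two homomorphisms, postcomposition with \<open>stream_unfold\<close> and
  the inverse of the comparison map; it agrees with the definition by extensionality.\<close>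

lemma E_delta_hom: "E_delta A B \<in> magma_hom A (E_magma A B) (copower A B (E_magma A B))"
proof -
  let ?E = "E_magma A B" and ?C = "copower_streams_top B"
  let ?k = "restrict (inv_into (mcarrier (copower A B ?E)) (comparison A B))
    (mcarrier (Top_magma A ?C))"
  have "?k \<in> magma_hom A (Top_magma A ?C) (copower A B ?E)"
    by (rule inv_into_magma_hom[OF is_magma_copower[OF is_magma_E_magma] comparison_hom])
      (simp add: Top_magma_simps bij_betw_comparison)
  from magma_hom_compose[OF is_magma_E_magma stream_unfold_hom this]
  have "compose (mcarrier ?E) ?k (postcomp A (streams_top B) stream_unfold) \<in>
      magma_hom A ?E (copower A B ?E)" .
  also have "compose (mcarrier ?E) ?k (postcomp A (streams_top B) stream_unfold) = E_delta A B"
  proof (rule extensionalityI[of _ "mcarrier ?E"])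
    fix f assume "f \<in> mcarrier ?E"
    then have f: "f \<in> Top (streams_top A) (streams_top B)"
      by (simp add: Top_magma_simps)
    then show "compose (mcarrier ?E) ?k (postcomp A (streams_top B) stream_unfold) f =
        E_delta A B f"
      using postcomp_Top[OF continuous_map_stream_unfold f]
      by (simp add: compose_eq E_delta_def Top_magma_simps postcomp_def)
  qed (simp_all add: E_delta_def Top_magma_simps compose_def)
  finally show ?thesis .
qed

text \<open>Together with injectivity of the comparison map this determines \<open>E_delta\<close>,
  so \<open>inv_into\<close> need not be unfolded again.\<close>

lemma comparison_E_delta:
  assumes "f \<in> Top (streams_top A) (streams_top B)"
  shows "comparison A B (E_delta A B f) = postcomp A (streams_top B) stream_unfold f"
proof -
  have "postcomp A (streams_top B) stream_unfold f \<in>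
      comparison A B ` mcarrier (copower A B (E_magma A B))"
    using bij_betw_comparison postcomp_Top[OF continuous_map_stream_unfold assms]
    by (metis bij_betw_imp_surj_on)
  then show ?thesis
    using assms by (simp add: E_delta_def postcomp_def f_inv_into_f)
qed

lemma bimodel_E: "bimodel A B (E_magma A B) (E_delta A B)"
  by (simp add: bimodel_def is_magma_E_magma E_delta_hom)

section \<open>Finality\<close>

text \<open>The summand label is read at index \<open>0\<close>; at \<open>Suc n\<close> it is
  forgotten and coordinate \<open>n\<close> is taken inside the summand. The cotuples are meaningful
  only once each coordinate is known to be a homomorphism, which \<open>coordinate_hom\<close>
  proves along the same recursion.\<close>

primrec coordinate :: "'a set \<Rightarrow> 'b set \<Rightarrow> ('a, 'k) magma \<Rightarrow>
    ('k \<Rightarrow> ('a, 'b \<times> 'k) mterm set) \<Rightarrow> nat \<Rightarrow> 'k \<Rightarrow> (nat \<Rightarrow> 'a) \<Rightarrow> 'b" where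
  "coordinate A B K \<delta> 0 = compose (mcarrier K)
    (cotuple A B (\<lambda>_. K) (Top_magma A (discrete_topology B))
      (\<lambda>b. \<lambda>x\<in>mcarrier K. \<lambda>s\<in>topspace (streams_top A). b)) \<delta>"
| "coordinate A B K \<delta> (Suc n) = compose (mcarrier K)
    (cotuple A B (\<lambda>_. K) (Top_magma A (discrete_topology B)) (\<lambda>_. coordinate A B K \<delta> n)) \<delta>"

text \<open>Splitting a family of constant maps with the common value \<open>b\<close> gives that
  constant map again.\<close>

lemma const_hom:
  assumes K: "is_magma A K" and b: "b \<in> B"
  shows "(\<lambda>x\<in>mcarrier K. \<lambda>s\<in>topspace (streams_top A). b) \<in>
    magma_hom A K (Top_magma A (discrete_topology B))"
proof (rule magma_homI)
  fix F assume F: "F \<in> A \<rightarrow>\<^sub>E mcarrier K"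
  have "F (s 0) \<in> mcarrier K" "s 0 \<in> A" "shift s \<in> topspace (streams_top A)"
    if "s \<in> topspace (streams_top A)" for s
    using that F by (auto simp: topspace_streams_top shift_def)
  then show "(\<lambda>x\<in>mcarrier K. \<lambda>s\<in>topspace (streams_top A). b) (mop K F) =
      mop (Top_magma A (discrete_topology B))
        (\<lambda>a\<in>A. (\<lambda>x\<in>mcarrier K. \<lambda>s\<in>topspace (streams_top A). b) (F a))"
    using is_magmaD[OF K F] by (simp add: Top_magma_simps split_def fun_eq_iff)
qed (use b in \<open>simp_all add: Top_magma_simps Top_restrictI\<close>)

lemma coordinate_hom:
  assumes "bimodel A B K \<delta>"
  shows "coordinate A B K \<delta> n \<in> magma_hom A K (Top_magma A (discrete_topology B))"
proof -
  have K: "is_magma A K" and \<delta>: "\<delta> \<in> magma_hom A K (coprod A B (\<lambda>_. K))"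
    using assms by (auto simp: bimodel_def copower_def)
  show ?thesis
  proof (induction n)
    case 0
    show ?case
      unfolding coordinate.simps
      by (rule magma_hom_compose[OF K \<delta> cotuple_hom])
        (simp_all add: K is_magma_Top_magma const_hom)
  next
    case (Suc n)
    then show ?case
      unfolding coordinate.simps
      by (intro magma_hom_compose[OF K \<delta> cotuple_hom]) (simp_all add: K is_magma_Top_magma)
  qed
qed

section \<open>Functoriality of copowers and the unfolding of bimodel maps\<close>

lemma
  assumes K: "is_magma A K" and L: "is_magma A L" and f: "f \<in> magma_hom A K L"
  shows copower_map_hom: "copower_map A B K L f \<in> magma_hom A (copower A B K) (copower A B L)"
    and copower_map_coprod_inj: "b \<in> B \<Longrightarrow> x \<in> mcarrier K \<Longrightarrow>
      copower_map A B K L f (coprod_inj A B (\<lambda>_. K) b x) = coprod_inj A B (\<lambda>_. L) b (f x)"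
proof -
  \<comment> \<open>Restricting the generator maps to the carrier does not change the cotuple.\<close>
  have eq: "copower_map A B K L f = cotuple A B (\<lambda>_. K) (copower A B L)
      (\<lambda>b. compose (mcarrier K) (coprod_inj A B (\<lambda>_. L) b) f)"
    by (simp add: copower_map_def cotuple_def compose_eq)
  have g: "\<forall>b\<in>B. compose (mcarrier K) (coprod_inj A B (\<lambda>_. L) b) f \<in> magma_hom A K (copower A B L)"
    using magma_hom_compose[OF K f coprod_inj_hom[of B A "\<lambda>_. L"]] L by (simp add: copower_def)
  show "copower_map A B K L f \<in> magma_hom A (copower A B K) (copower A B L)"
    unfolding eq copower_def[of A B K]
    by (rule cotuple_hom) (use K g is_magma_copower[OF L] in auto)
  show "copower_map A B K L f (coprod_inj A B (\<lambda>_. K) b x) = coprod_inj A B (\<lambda>_. L) b (f x)"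
    if "b \<in> B" "x \<in> mcarrier K"
    unfolding eq using K g is_magma_copower[OF L] that
    by (subst cotuple_coprod_inj) (auto simp: compose_eq)
qed

text \<open>As functions of \<open>z\<close>, both sides are homomorphisms out of a coproduct that
  agree on generators. Taking \<open>p\<close> to be \<open>fst\<close>, or a coordinate of
  \<open>snd\<close>, gives the head and the later entries of one side of the bimodel
  equation.\<close>

lemma postcomp_comparison_copower_map:
  assumes K: "is_magma A K" and f: "f \<in> magma_hom A K (E_magma A B)"
    and p: "continuous_map (copower_streams_top B) (discrete_topology B) p"
    and h: "\<And>b. b \<in> B \<Longrightarrow> h b \<in> magma_hom A K (Top_magma A (discrete_topology B))"
    and hp: "\<And>b x s. b \<in> B \<Longrightarrow> x \<in> mcarrier K \<Longrightarrow> s \<in> topspace (streams_top A) \<Longrightarrow>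
      h b x s = p (b, f x s)"
    and z: "z \<in> mcarrier (copower A B K)"
  shows "postcomp A (copower_streams_top B) p
      (comparison A B (copower_map A B K (E_magma A B) f z)) =
    cotuple A B (\<lambda>_. K) (Top_magma A (discrete_topology B)) h z"
proof -
  let ?D = "Top_magma A (discrete_topology B)" and ?CK = "copower A B K"
  let ?Bf = "copower_map A B K (E_magma A B) f" and ?p = "postcomp A (copower_streams_top B) p"
  \<comment> \<open>The left-hand side as a function of \<open>z\<close>, with each composite
    restricted to the carrier so that it is a homomorphism.\<close>
  let ?g = "compose (mcarrier ?CK) ?p (compose (mcarrier ?CK) (comparison A B) ?Bf)"
  have Bf: "?Bf \<in> magma_hom A ?CK (copower A B (E_magma A B))"
    by (rule copower_map_hom[OF K is_magma_E_magma f])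
  have g: "?g \<in> magma_hom A (coprod A B (\<lambda>_. K)) ?D"
    using magma_hom_compose[OF is_magma_copower[OF K]
        magma_hom_compose[OF is_magma_copower[OF K] Bf comparison_hom] postcomp_hom[OF p]]
    by (simp add: copower_def)
  have c: "cotuple A B (\<lambda>_. K) ?D h \<in> magma_hom A (coprod A B (\<lambda>_. K)) ?D"
    using h by (intro cotuple_hom) (auto simp: K is_magma_Top_magma)
  have "?g = cotuple A B (\<lambda>_. K) ?D h"
  proof (rule coprod_hom_eqI[OF _ is_magma_Top_magma g c])
    fix b x assume b: "b \<in> B" and x: "x \<in> mcarrier K"
    have fx: "f x \<in> Top (streams_top A) (streams_top B)"
      using magma_homD(1)[OF f x] by (simp add: Top_magma_simps)
    have "coprod_inj A B (\<lambda>_. K) b x \<in> mcarrier ?CK"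
      using magma_homD(1)[OF coprod_inj_hom[of B A "\<lambda>_. K"] x] b K by (simp add: copower_def)
    then have "?g (coprod_inj A B (\<lambda>_. K) b x) = ?p (postcomp A (streams_top B) (Pair b) (f x))"
      using copower_map_coprod_inj[OF K is_magma_E_magma f b x] comparison_coprod_inj[OF b fx]
      by (simp add: compose_eq)
    also have "\<dots> = h b x"
    proof (rule Top_eqI)
      have q: "postcomp A (streams_top B) (Pair b) (f x) \<in>
          Top (streams_top A) (copower_streams_top B)"
        by (rule postcomp_Top[OF continuous_map_Pair_copower[OF b] fx])
      then show "?p (postcomp A (streams_top B) (Pair b) (f x)) \<in>
          Top (streams_top A) (discrete_topology B)"
        by (rule postcomp_Top[OF p])
      show "h b x \<in> Top (streams_top A) (discrete_topology B)"
        using magma_homD(1)[OF h[OF b] x] by (simp add: Top_magma_simps)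
      show "?p (postcomp A (streams_top B) (Pair b) (f x)) s = h b x s"
        if "s \<in> topspace (streams_top A)" for s
        using that by (simp add: postcomp_apply q fx hp b x)
    qed
    also have "h b x = cotuple A B (\<lambda>_. K) ?D h (coprod_inj A B (\<lambda>_. K) b x)"
      using h b x by (subst cotuple_coprod_inj) (auto simp: K is_magma_Top_magma)
    finally show "?g (coprod_inj A B (\<lambda>_. K) b x) =
        cotuple A B (\<lambda>_. K) ?D h (coprod_inj A B (\<lambda>_. K) b x)" .
  qed (use K in simp)
  then show ?thesis
    using z by (auto simp: compose_eq dest!: fun_cong[of _ _ z])
qed

text \<open>Applying the injective comparison map turns the bimodel equation into one between
  continuous maps into the coproduct of stream spaces. Its \<open>fst\<close> and \<open>snd\<close>
  components are exactly the recursion defining \<open>coordinate\<close>.\<close>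

lemma bimodel_map_E_iff:
  assumes bm: "bimodel A B K \<delta>" and f: "f \<in> magma_hom A K (E_magma A B)"
  shows "f \<in> bimodel_map A B K \<delta> (E_magma A B) (E_delta A B) \<longleftrightarrow>
    (\<forall>n. \<forall>x\<in>mcarrier K. \<forall>s\<in>topspace (streams_top A). f x s n = coordinate A B K \<delta> n x s)"
    (is "?lhs \<longleftrightarrow> ?rhs")
proof -
  let ?E = "E_magma A B" and ?S = "streams_top A" and ?C = "copower_streams_top B"
  let ?D = "Top_magma A (discrete_topology B)"
  let ?hd = "cotuple A B (\<lambda>_. K) ?D (\<lambda>b. \<lambda>x\<in>mcarrier K. \<lambda>s\<in>topspace ?S. b)"
  define nth where "nth n = compose (mcarrier K) (postcomp A (streams_top B) (\<lambda>y. y n)) f" for n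
  have K: "is_magma A K" and \<delta>: "\<delta> \<in> magma_hom A K (copower A B K)"
    using bm by (auto simp: bimodel_def)
  have fx: "f x \<in> Top ?S (streams_top B)" if "x \<in> mcarrier K" for x
    using magma_homD(1)[OF f that] by (simp add: Top_magma_simps)
  have nth: "nth n \<in> magma_hom A K ?D" for n
    unfolding nth_def
    by (rule magma_hom_compose[OF K f]) (simp add: E_magma_def postcomp_hom continuous_map_nth)
  have nth_apply: "nth n x s = f x s n" if "x \<in> mcarrier K" "s \<in> topspace ?S" for n x s
    using that by (simp add: nth_def compose_eq postcomp_apply fx)
  \<comment> \<open>One side of the bimodel equation, transported along the comparison map; the
    other side becomes the unfolding of \<open>f x\<close>.\<close>
  let ?G = "\<lambda>x. comparison A B (copower_map A B K ?E f (\<delta> x))"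
  have Bf: "copower_map A B K ?E f (\<delta> x) \<in> mcarrier (copower A B ?E)" if "x \<in> mcarrier K" for x
    using magma_homD(1)[OF copower_map_hom[OF K is_magma_E_magma f]]
      magma_homD(1)[OF \<delta> that] by blast
  have G: "?G x \<in> Top ?S ?C" if "x \<in> mcarrier K" for x
    using magma_homD(1)[OF comparison_hom Bf[OF that]] by (simp add: Top_magma_simps)
  have fst_G: "fst (?G x s) = ?hd (\<delta> x) s"
    if x: "x \<in> mcarrier K" and s: "s \<in> topspace ?S" for x s
  proof -
    have "postcomp A ?C fst (?G x) = ?hd (\<delta> x)"
      by (rule postcomp_comparison_copower_map[OF K f continuous_map_fst_copower])
        (simp_all add: const_hom[OF K] magma_homD(1)[OF \<delta> x])
    then show ?thesis
      using postcomp_apply[OF G[OF x] s, of fst] by simp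
  qed
  have snd_G: "snd (?G x s) n = cotuple A B (\<lambda>_. K) ?D (\<lambda>_. nth n) (\<delta> x) s"
    if x: "x \<in> mcarrier K" and s: "s \<in> topspace ?S" for x s n
  proof -
    have "postcomp A ?C (\<lambda>p. snd p n) (?G x) = cotuple A B (\<lambda>_. K) ?D (\<lambda>_. nth n) (\<delta> x)"
      by (rule postcomp_comparison_copower_map[OF K f continuous_map_snd_nth_copower])
        (simp_all add: nth nth_apply magma_homD(1)[OF \<delta> x])
    then show ?thesis
      using postcomp_apply[OF G[OF x] s, of "\<lambda>p. snd p n"] by simp
  qed
  \<comment> \<open>Pointwise agreement is strengthened to equality of functions, so that it can be
    rewritten inside a cotuple.\<close>
  have nth_eq: "nth n = coordinate A B K \<delta> n"
    if eq: "\<forall>x\<in>mcarrier K. \<forall>s\<in>topspace ?S. f x s n = coordinate A B K \<delta> n x s" for n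
  proof (rule magma_hom_eqI[OF nth coordinate_hom[OF bm]])
    fix x assume x: "x \<in> mcarrier K"
    show "nth n x = coordinate A B K \<delta> n x"
    proof (rule Top_eqI)
      show "nth n x \<in> Top ?S (discrete_topology B)"
        using magma_homD(1)[OF nth x] by (simp add: Top_magma_simps)
      show "coordinate A B K \<delta> n x \<in> Top ?S (discrete_topology B)"
        using magma_homD(1)[OF coordinate_hom[OF bm] x] by (simp add: Top_magma_simps)
    qed (use eq x nth_apply in simp)
  qed
  have "?lhs \<longleftrightarrow> (\<forall>x\<in>mcarrier K. E_delta A B (f x) = copower_map A B K ?E f (\<delta> x))"
    using f by (simp add: bimodel_map_def)
  also have "\<dots> \<longleftrightarrow> (\<forall>x\<in>mcarrier K. postcomp A (streams_top B) stream_unfold (f x) = ?G x)"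
  proof (rule ball_cong[OF HOL.refl])
    fix x assume x: "x \<in> mcarrier K"
    have "E_delta A B (f x) \<in> mcarrier (copower A B ?E)"
      using magma_homD(1)[OF E_delta_hom] fx[OF x] by (simp add: Top_magma_simps)
    then show "E_delta A B (f x) = copower_map A B K ?E f (\<delta> x) \<longleftrightarrow>
        postcomp A (streams_top B) stream_unfold (f x) = ?G x"
      using inj_on_eq_iff[OF inj_on_comparison _ Bf[OF x]] comparison_E_delta[OF fx[OF x]]
      by metis
  qed
  also have "\<dots> \<longleftrightarrow> (\<forall>x\<in>mcarrier K. \<forall>s\<in>topspace ?S. stream_unfold (f x s) = ?G x s)"
  proof (rule ball_cong[OF HOL.refl])
    fix x assume x: "x \<in> mcarrier K"
    show "postcomp A (streams_top B) stream_unfold (f x) = ?G x \<longleftrightarrow>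
        (\<forall>s\<in>topspace ?S. stream_unfold (f x s) = ?G x s)"
      using Top_eqI[OF postcomp_Top[OF continuous_map_stream_unfold fx[OF x]] G[OF x]]
        postcomp_apply[OF fx[OF x]] by metis
  qed
  also have "\<dots> \<longleftrightarrow> (\<forall>x\<in>mcarrier K. \<forall>s\<in>topspace ?S. f x s 0 = ?hd (\<delta> x) s \<and>
      (\<forall>n. f x s (Suc n) = cotuple A B (\<lambda>_. K) ?D (\<lambda>_. nth n) (\<delta> x) s))"
    by (simp add: prod_eq_iff fst_G snd_G stream_unfold_def shift_def fun_eq_iff)
  also have "\<dots> \<longleftrightarrow> ?rhs"
  proof
    assume *: "\<forall>x\<in>mcarrier K. \<forall>s\<in>topspace ?S. f x s 0 = ?hd (\<delta> x) s \<and>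
      (\<forall>n. f x s (Suc n) = cotuple A B (\<lambda>_. K) ?D (\<lambda>_. nth n) (\<delta> x) s)"
    show ?rhs
    proof
      fix n
      show "\<forall>x\<in>mcarrier K. \<forall>s\<in>topspace ?S. f x s n = coordinate A B K \<delta> n x s"
      proof (induction n)
        case 0
        then show ?case
          using * by (simp add: compose_eq)
      next
        \<comment> \<open>Agreement at \<open>n\<close> turns the cotuple of \<open>nth n\<close>
          into that of \<open>coordinate\<close> at \<open>n\<close>, whose composite with
          \<open>\<delta>\<close> is the coordinate at \<open>Suc n\<close>.\<close>
        case (Suc n)
        then show ?case
          using * by (simp add: compose_eq nth_eq)
      qed
    qed
  next
    assume *: ?rhs
    then have "nth n = coordinate A B K \<delta> n" for n
      by (simp add: nth_eq)
    then show "\<forall>x\<in>mcarrier K. \<forall>s\<in>topspace ?S. f x s 0 = ?hd (\<delta> x) s \<and>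
        (\<forall>n. f x s (Suc n) = cotuple A B (\<lambda>_. K) ?D (\<lambda>_. nth n) (\<delta> x) s)"
      using *[rule_format, of _ _ 0] *[rule_format, of _ _ "Suc _"] by (simp add: compose_eq)
  qed
  finally show ?thesis .
qed

text \<open>Continuity into a product and the operation \<open>split\<close> are both determined
  coordinatewise.\<close>

lemma tuple_hom:
  assumes h: "\<And>n. h n \<in> magma_hom A K (Top_magma A (discrete_topology B))"
    and K: "is_magma A K"
  shows "(\<lambda>x\<in>mcarrier K. \<lambda>s\<in>topspace (streams_top A). \<lambda>n. h n x s) \<in>
    magma_hom A K (E_magma A B)"
proof (rule magma_homI)
  fix x assume x: "x \<in> mcarrier K"
  have "continuous_map (streams_top A) (discrete_topology B) (h n x)" for n
    using magma_homD(1)[OF h x] by (simp add: Top_magma_simps Top_def)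
  then show "(\<lambda>x\<in>mcarrier K. \<lambda>s\<in>topspace (streams_top A). \<lambda>n. h n x s) x \<in>
      mcarrier (E_magma A B)"
    using x by (auto simp: Top_magma_simps continuous_map_streams_top intro!: Top_restrictI)
next
  fix F assume F: "F \<in> A \<rightarrow>\<^sub>E mcarrier K"
  have m: "mop K F \<in> mcarrier K"
    using K F by (auto simp: is_magma_def)
  have "h n (mop K F) s = h n (F (s 0)) (shift s)" "F (s 0) \<in> mcarrier K"
      "s 0 \<in> A" "shift s \<in> topspace (streams_top A)"
    if "s \<in> topspace (streams_top A)" for n s
    using that F by (auto simp: magma_homD(2)[OF h F] Top_magma_simps split_def
        topspace_streams_top shift_def)
  then show "(\<lambda>x\<in>mcarrier K. \<lambda>s\<in>topspace (streams_top A). \<lambda>n. h n x s) (mop K F) =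
      mop (E_magma A B)
        (\<lambda>a\<in>A. (\<lambda>x\<in>mcarrier K. \<lambda>s\<in>topspace (streams_top A). \<lambda>n. h n x s) (F a))"
    using m by (auto simp: Top_magma_simps split_def fun_eq_iff)
qed simp

text \<open>The tuple of the coordinates satisfies the criterion for bimodel maps, and the criterion
  fixes every value of any competing map.\<close>

lemma final_bimodel_E: "final_bimodel TYPE('k) A B (E_magma A B) (E_delta A B)"
  unfolding final_bimodel_def
proof (intro conjI allI impI bimodel_E)
  fix K :: "('a, 'k) magma" and \<delta>
  assume bm: "bimodel A B K \<delta>"
  let ?maps = "bimodel_map A B K \<delta> (E_magma A B) (E_delta A B)"
  let ?f = "\<lambda>x\<in>mcarrier K. \<lambda>s\<in>topspace (streams_top A). \<lambda>n. coordinate A B K \<delta> n x s"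
  have f: "?f \<in> magma_hom A K (E_magma A B)"
    using bm by (intro tuple_hom coordinate_hom) (auto simp: bimodel_def)
  show "\<exists>!f. f \<in> ?maps"
  proof (rule ex1I)
    show "?f \<in> ?maps"
      by (simp add: bimodel_map_E_iff[OF bm f])
  next
    fix g assume "g \<in> ?maps"
    then have g: "g \<in> magma_hom A K (E_magma A B)"
      and coord: "\<And>n x s. x \<in> mcarrier K \<Longrightarrow> s \<in> topspace (streams_top A) \<Longrightarrow>
        g x s n = coordinate A B K \<delta> n x s"
      using bimodel_map_E_iff[OF bm, of g] by (auto simp: bimodel_map_def)
    show "g = ?f"
    proof (rule magma_hom_eqI[OF g f])
      fix x assume x: "x \<in> mcarrier K"
      have "g x \<in> Top (streams_top A) (streams_top B)" "?f x \<in> Top (streams_top A) (streams_top B)"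
        using magma_homD(1)[OF g x] magma_homD(1)[OF f x] unfolding Top_magma_simps .
      then show "g x = ?f x"
        by (rule Top_eqI) (simp add: fun_eq_iff coord x)
    qed
  qed
qed

theorem theorem5p11:
  fixes A :: "'a set" and B :: "'b set"
  shows "final_bimodel TYPE('k) A B (E_magma A B) (E_delta A B) \<and>
    (\<exists>K \<delta>. mcarrier K = Top (streams_top A) (streams_top B) \<and> final_bimodel TYPE('k) A B K \<delta>)"
  \<comment> \<open>The existential is witnessed by \<open>E_magma A B\<close> and
    \<open>E_delta A B\<close> themselves.\<close>
  using final_bimodel_E Top_magma_simps(3) by blast

end
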